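(* Let $F=\Bbbk\langle x,y\rangle$. If $D$ is a locally nilpotent $\Bbbk$-derivation of $F$ and $\pi_\ast(D)=0$, then $D=0$. Equivalently, $$\ker(\pi_\ast)\cap\mathrm{LND}(F)=\{0\}.$$
   Context: $\Bbbk$ is an algebraically closed field of characteristic zero and $F=\Bbbk\langle x,y\rangle$ is the free associative unital $\Bbbk$-algebra on two generators. $\pi:F\to\Bbbk[x,y]$ is the natural abelianization map ($x\mapsto x$, $y\mapsto y$), whose kernel $I$ is the two-sided ideal generated by $[x,y]=xy-yx$. Every $\Bbbk$-derivation $D$ of $F$ satisfies $D(I)\subseteq I$ and hence induces a $\Bbbk$-derivation $\pi_\ast(D)$ of $\Bbbk[x,y]$, characterized by $\pi_\ast(D)(\pi(a))=\pi(D(a))$ for all $a\in F$; this defines a linear map $\pi_\ast:\mathrm{Der}(F)\to\mathrm{Der}(\Bbbk[x,y])$ between spaces of $\Bbbk$-derivations. A derivation $D$ of $F$ is locally nilpotent if for every $a\in F$ there is $n\ge1$ with $D^n(a)=0$; $\mathrm{LND}(F)$ is the set of locally nilpotent $\Bbbk$-derivations of $F$. *)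

theory Defs
  imports "HOL-Library.Poly_Mapping" "HOL-Computational_Algebra.Polynomial"
begin

section \<open>Algebras and derivations\<close>

text \<open>Lists under concatenation form the free monoid. Since multiplication of
  \<^typ>\<open>'m \<Rightarrow>\<^sub>0 'k\<close> is convolution along \<open>+\<close> on \<open>'m\<close>, the additive notation is needed here.\<close>

instantiation list :: (type) monoid_add
begin
definition zero_list :: "'a list" where "zero_list = []"
definition plus_list :: "'a list \<Rightarrow> 'a list \<Rightarrow> 'a list" where "plus_list u v = u @ v"
instance by standard (simp_all add: zero_list_def plus_list_def)
end

datatype gen = gen_x | gen_y

type_synonym 'k free_alg = "gen list \<Rightarrow>\<^sub>0 'k"
type_synonym 'k poly_xy = "(gen \<Rightarrow>\<^sub>0 nat) \<Rightarrow>\<^sub>0 'k"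

definition scale :: "'k::field \<Rightarrow> ('m::monoid_add \<Rightarrow>\<^sub>0 'k) \<Rightarrow> ('m \<Rightarrow>\<^sub>0 'k)" where
  "scale c a = Poly_Mapping.single 0 c * a"

lemma vector_space_scale: "vector_space scale"
  by standard (simp_all add: scale_def algebra_simps single_add mult_single flip: mult.assoc)

definition derivation :: "(('m::monoid_add \<Rightarrow>\<^sub>0 'k::field) \<Rightarrow> ('m \<Rightarrow>\<^sub>0 'k)) \<Rightarrow> bool" where
  "derivation D \<longleftrightarrow> Vector_Spaces.linear scale scale D \<and> (\<forall>a b. D (a * b) = D a * b + a * D b)"

definition Der :: "(('m::monoid_add \<Rightarrow>\<^sub>0 'k::field) \<Rightarrow> ('m \<Rightarrow>\<^sub>0 'k)) set" where
  "Der = {D. derivation D}"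

definition locally_nilpotent :: "('a::zero \<Rightarrow> 'a) \<Rightarrow> bool" where
  "locally_nilpotent D \<longleftrightarrow> (\<forall>a. \<exists>n\<ge>1. (D ^^ n) a = 0)"

definition LND :: "(('m::monoid_add \<Rightarrow>\<^sub>0 'k::field) \<Rightarrow> ('m \<Rightarrow>\<^sub>0 'k)) set" where
  "LND = {D \<in> Der. locally_nilpotent D}"

section \<open>Abelianization\<close>

definition free_var :: "gen \<Rightarrow> 'k::field free_alg" where
  "free_var g = Poly_Mapping.single [g] 1"

definition poly_var :: "gen \<Rightarrow> 'k::field poly_xy" where
  "poly_var g = Poly_Mapping.single (Poly_Mapping.single g 1) 1"

definition abelianize :: "'k::field free_alg \<Rightarrow> 'k poly_xy" where
  "abelianize a =
     (\<Sum>w\<in>Poly_Mapping.keys a. scale (Poly_Mapping.lookup a w) (prod_list (map poly_var w)))"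

definition pi_star ::
  "('k::field free_alg \<Rightarrow> 'k free_alg) \<Rightarrow> ('k poly_xy \<Rightarrow> 'k poly_xy)" where
  "pi_star D = (THE E. derivation E \<and> (\<forall>a. E (abelianize a) = abelianize (D a)))"

text \<open>The rest of the theory shows that \<^const>\<open>abelianize\<close> is a surjective algebra
  homomorphism and that, for a derivation \<^term>\<open>D\<close>, exactly one map meets the description
  defining \<^term>\<open>pi_star D\<close>.\<close>

lemma pm_induct [case_names zero single add]:
  fixes a :: "'m \<Rightarrow>\<^sub>0 'k::comm_monoid_add"
  assumes "P 0" "\<And>m c. P (Poly_Mapping.single m c)" "\<And>a b. P a \<Longrightarrow> P b \<Longrightarrow> P (a + b)"
  shows "P a"
proof -
  have "P (\<Sum>m\<in>S. Poly_Mapping.single m (f m))" if "finite S" for S and f :: "'m \<Rightarrow> 'k"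
    using that by (induction S rule: finite_induct) (auto intro: assms)
  moreover have "a = (\<Sum>m\<in>Poly_Mapping.keys a. Poly_Mapping.single m (Poly_Mapping.lookup a m))"
    by (rule poly_mapping_eqI)
       (simp add: lookup_sum lookup_single when_def not_in_keys_iff_lookup_eq_zero)
  ultimately show ?thesis by (metis finite_keys)
qed

definition lin_ext :: "('m \<Rightarrow> ('n::monoid_add \<Rightarrow>\<^sub>0 'k::field)) \<Rightarrow> ('m \<Rightarrow>\<^sub>0 'k) \<Rightarrow> ('n \<Rightarrow>\<^sub>0 'k)" where
  "lin_ext f a = (\<Sum>m\<in>Poly_Mapping.keys a. scale (Poly_Mapping.lookup a m) (f m))"

lemma scale_simps [simp]:
  "scale 0 a = 0" "scale c 0 = 0" "scale 1 a = a"
  "scale c (scale d a) = scale (c * d) a"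
  "scale c (Poly_Mapping.single m d) = Poly_Mapping.single m (c * d)"
  "scale c a * b = scale c (a * b)"
  by (simp_all add: scale_def mult_single flip: mult.assoc)

lemma scale_add: "scale (c + d) a = scale c a + scale d a" "scale c (a + b) = scale c a + scale c b"
  by (simp_all add: scale_def single_add algebra_simps)

lemma mult_scale: "a * scale c b = scale c (a * b)"
  for a :: "'m::monoid_add \<Rightarrow>\<^sub>0 'k::field"
proof (induction a rule: pm_induct)
  case (single m d)
  then show ?case
    by (simp add: scale_def mult_single mult.commute flip: mult.assoc)
qed (simp_all add: algebra_simps scale_add)

lemma lin_ext_superset:
  assumes "finite S" "Poly_Mapping.keys a \<subseteq> S"
  shows "lin_ext f a = (\<Sum>m\<in>S. scale (Poly_Mapping.lookup a m) (f m))"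
  unfolding lin_ext_def using assms
  by (intro sum.mono_neutral_left) (auto simp: not_in_keys_iff_lookup_eq_zero)

lemma lin_ext_single [simp]: "lin_ext f (Poly_Mapping.single m c) = scale c (f m)"
  by (subst lin_ext_superset[of "{m}"]) auto

lemma lin_ext_zero [simp]: "lin_ext f 0 = 0"
  by (simp add: lin_ext_def)

lemma lin_ext_add [simp]: "lin_ext f (a + b) = lin_ext f a + lin_ext f b"
proof -
  let ?S = "Poly_Mapping.keys a \<union> Poly_Mapping.keys b"
  show ?thesis
    by (subst (1 2 3) lin_ext_superset[of ?S])
       (use keys_add[of a b] in \<open>auto simp: lookup_add scale_add sum.distrib\<close>)
qed

lemma lin_ext_scale [simp]: "lin_ext f (scale c a) = scale c (lin_ext f a)"
  for a :: "'m::monoid_add \<Rightarrow>\<^sub>0 'k::field"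
  by (induction a rule: pm_induct) (simp_all add: scale_add)

lemma abelianize_eq: "abelianize = lin_ext (\<lambda>w. prod_list (map poly_var w))"
  by (rule ext) (simp add: abelianize_def lin_ext_def)

lemma abelianize_single [simp]:
  "abelianize (Poly_Mapping.single w c) = scale c (prod_list (map poly_var w))"
  by (simp add: abelianize_eq)

lemma abelianize_zero [simp]: "abelianize 0 = 0"
  by (simp add: abelianize_eq)

lemma abelianize_add [simp]: "abelianize (a + b) = abelianize a + abelianize b"
  by (simp add: abelianize_eq)

lemma abelianize_scale [simp]: "abelianize (scale c a) = scale c (abelianize a)"
  by (simp add: abelianize_eq)

lemma abelianize_mult [simp]: "abelianize (a * b) = abelianize a * abelianize b"
proof (induction a rule: pm_induct)
  case (single u c)
  show ?case
    by (induction b rule: pm_induct)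
       (simp_all add: algebra_simps mult_single plus_list_def mult_scale scale_add)
qed (simp_all add: algebra_simps)

lemma abelianize_one: "abelianize 1 = 1"
  by (simp add: zero_list_def flip: single_one)

lemma abelianize_free_var [simp]: "abelianize (free_var g) = poly_var g"
  by (simp add: free_var_def)

definition word_content :: "gen list \<Rightarrow> (gen \<Rightarrow>\<^sub>0 nat)" where
  "word_content w = (\<Sum>g\<leftarrow>w. Poly_Mapping.single g 1)"

lemma word_content_simps [simp]:
  "word_content [] = 0" "word_content (g # w) = Poly_Mapping.single g 1 + word_content w"
  "word_content (u @ v) = word_content u + word_content v"
  by (simp_all add: word_content_def)

lemma prod_list_poly_var:
  "prod_list (map poly_var w) = Poly_Mapping.single (word_content w) (1 :: 'k::field)"
  by (induction w) (simp_all add: poly_var_def mult_single)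

lemma surj_word_content: "\<exists>w. word_content w = m"
proof (induction m rule: pm_induct)
  case (single g n)
  have "word_content (replicate n g) = Poly_Mapping.single g n"
    by (induction n) (simp_all flip: single_add)
  then show ?case by blast
qed (metis word_content_simps)+

lemma surj_abelianize: "surj (abelianize :: 'k::field free_alg \<Rightarrow> 'k poly_xy)"
proof -
  have "\<exists>a. abelianize a = p" for p :: "'k poly_xy"
  proof (induction p rule: pm_induct)
    case (single m c)
    obtain w where "word_content w = m" using surj_word_content by blast
    then have "abelianize (Poly_Mapping.single w c) = Poly_Mapping.single m c"
      by (simp add: prod_list_poly_var)
    then show ?case by blast
  qed (metis abelianize_zero abelianize_add)+
  then show ?thesis by (metis surjI)
qed

lemma derivationD:
  assumes "derivation D"
  shows "D (a + b) = D a + D b" "D (scale c a) = scale c (D a)" "D 0 = 0"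
    "D (a * b) = D a * b + a * D b" "D 1 = 0"
proof -
  from assms have "module_hom scale scale D"
    by (simp add: derivation_def module_hom_iff_linear)
  then interpret module_hom scale scale D .
  show "D (a + b) = D a + D b" "D (scale c a) = scale c (D a)" "D 0 = 0"
    by (simp_all add: add scale)
  show *: "D (a * b) = D a * b + a * D b" for a b
    using assms by (simp add: derivation_def)
  show "D 1 = 0" using *[of 1 1] by simp
qed

lemma ex_induced:
  fixes D :: "'k::field free_alg \<Rightarrow> 'k free_alg"
  assumes D: "derivation D"
  shows "\<exists>E. derivation E \<and> (\<forall>a. E (abelianize a) = abelianize (D a))"
proof -
  define e :: "(gen \<Rightarrow>\<^sub>0 nat) \<Rightarrow> 'k poly_xy" where
    "e = (\<lambda>m. \<Sum>g\<in>{gen_x, gen_y}.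
       Poly_Mapping.single (m - Poly_Mapping.single g 1) (of_nat (Poly_Mapping.lookup m g))
         * abelianize (D (free_var g)))"
  have sh: "Poly_Mapping.single (Poly_Mapping.single g 1 + m - Poly_Mapping.single h 1)
         (of_nat (Poly_Mapping.lookup (Poly_Mapping.single g 1 + m) h))
     = (if g = h then Poly_Mapping.single m 1 else 0) + poly_var g *
         Poly_Mapping.single (m - Poly_Mapping.single h 1) (of_nat (Poly_Mapping.lookup m h) :: 'k)"
    for g h :: gen and m
  proof (cases "Poly_Mapping.lookup m h = 0")
    case True
    then show ?thesis
      by (auto simp: lookup_add lookup_single poly_var_def mult_single)
  next
    case False
    then have "Poly_Mapping.single g 1 + m - Poly_Mapping.single h 1
      = Poly_Mapping.single g 1 + (m - Poly_Mapping.single h 1)"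
      by (intro poly_mapping_eqI) (auto simp: lookup_add lookup_minus lookup_single when_def)
    moreover have "Poly_Mapping.single h 1 + (m - Poly_Mapping.single h 1) = m"
      using False
      by (intro poly_mapping_eqI) (auto simp: lookup_add lookup_minus lookup_single when_def)
    ultimately show ?thesis
      by (auto simp: lookup_add lookup_single poly_var_def mult_single single_add)
  qed
  have e_step: "e (Poly_Mapping.single g 1 + m) =
     Poly_Mapping.single m 1 * abelianize (D (free_var g)) + poly_var g * e m" for g m
    unfolding e_def sh by (cases g) (simp_all add: algebra_simps)
  have e_word: "e (word_content w) = abelianize (D (Poly_Mapping.single w 1))" for w
  proof (induction w)
    case Nil
    have "Poly_Mapping.single ([] :: gen list) (1::'k) = 1" by (metis single_one zero_list_def)
    then show ?case by (simp add: e_def derivationD[OF D])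
  next
    case (Cons g w)
    have "Poly_Mapping.single (g # w) (1::'k) = free_var g * Poly_Mapping.single w 1"
      by (simp add: free_var_def mult_single plus_list_def)
    then show ?case
      by (simp add: e_step[simplified] derivationD[OF D] Cons prod_list_poly_var mult.commute)
  qed
  have E: "lin_ext e (abelianize a) = abelianize (D a)" for a
  proof (induction a rule: pm_induct)
    case (single w c)
    have "Poly_Mapping.single w c = scale c (Poly_Mapping.single w 1)" by simp
    then show ?case
      by (simp only: abelianize_scale derivationD[OF D] lin_ext_scale flip: e_word)
         (simp add: prod_list_poly_var)
  qed (simp_all add: derivationD[OF D])
  have "lin_ext e (p * q) = lin_ext e p * q + p * lin_ext e q" for p q
  proof -
    obtain a b where "p = abelianize a" "q = abelianize b"
      using surj_abelianize by (metis surjD)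
    then show ?thesis
      by (simp add: E derivationD[OF D] flip: abelianize_mult)
  qed
  moreover have "Vector_Spaces.linear scale scale (lin_ext e)"
    unfolding module_hom_iff_linear[symmetric] using vector_space_scale
    by (auto intro!: module_hom.intro module_hom_axioms.intro simp: module_def vector_space_def)
  ultimately show ?thesis using E unfolding derivation_def by blast
qed

lemma pi_star_props:
  assumes "derivation D"
  shows "derivation (pi_star D)" "pi_star D (abelianize a) = abelianize (D a)"
proof -
  have "\<exists>!E. derivation E \<and> (\<forall>a. E (abelianize a) = abelianize (D a))"
  proof (rule ex_ex1I)
    show "\<exists>E. derivation E \<and> (\<forall>a. E (abelianize a) = abelianize (D a))"
      using assms by (rule ex_induced)
  next
    fix E E' assume "derivation E \<and> (\<forall>a. E (abelianize a) = abelianize (D a))"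
      "derivation E' \<and> (\<forall>a. E' (abelianize a) = abelianize (D a))"
    then show "E = E'" using surj_abelianize by (metis ext surjD)
  qed
  from theI'[OF this] show "derivation (pi_star D)" "pi_star D (abelianize a) = abelianize (D a)"
    unfolding pi_star_def by blast+
qed

end

theory Submission
  imports Defs
begin

text \<open>If \<open>pi_star D = 0\<close>, then \<open>D x\<close> and \<open>D y\<close> have zero abelianization, so none of their words
  is a power of a single generator (\<open>keys_of_abelianize_eq_0\<close>): every word contains both
  letters.

  Suppose that such a \<open>D\<close> is locally nilpotent and nonzero. The component of \<open>D\<close> of highest degree
  with respect to a grading is again locally nilpotent and nonzero (\<open>ex_top_component\<close>). Doing this
  for the degree in \<open>x\<close> and then for the degree in \<open>y\<close>, one may assume that \<open>D\<close> is
  homogeneous of some bidegree \<open>(a, b)\<close>; since the words of \<open>D x\<close> and \<open>D y\<close> contain both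
  letters, \<open>a\<close> and \<open>b\<close> are nonnegative.

  Let \<open>X = D ^ m x\<close> and \<open>Y = D ^ n y\<close> be the last nonzero iterates. By the Leibniz rule
  the last nonzero iterate of a word is, up to a nonzero factor, the same word in \<open>X\<close> and
  \<open>Y\<close> (\<open>funpow_derivation_mult_top\<close>). By bihomogeneity the order of
  this iterate is the same for all words of \<open>f = D x\<close>, and it is at least \<open>m\<close>, as these words
  contain \<open>x\<close>; but \<open>f\<close> itself is killed by \<open>D ^ m\<close>. Hence the words of \<open>f\<close>, evaluated at
  \<open>X\<close> and \<open>Y\<close>, satisfy a linear relation with nonzero coefficients, unless \<open>f = 0\<close>; likewise
  for \<open>D y\<close>.

  But \<open>X\<close> and \<open>Y\<close> generate a free algebra. Two words that do not commute form a code
  (\<open>substitution_inj\<close>), so it suffices that the leading words of \<open>X\<close> and \<open>Y\<close> do not commute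
  (\<open>no_relation_of_leading_words\<close>). Commuting words are powers of one word and have
  proportional bidegrees, while \<open>X\<close> and \<open>Y\<close> have bidegrees \<open>(1 + m a, m b)\<close> and
  \<open>(n a, 1 + n b)\<close>, with determinant \<open>1 + m a + n b > 0\<close>. So \<open>D x = D y = 0\<close>, a contradiction
  (\<open>bihomogeneous_locally_nilpotent_eq_0\<close>).\<close>

section \<open>Derivations of the free algebra\<close>

lemma derivationI:
  assumes "\<And>a b. D (a + b) = D a + D b" "\<And>c a. D (scale c a) = scale c (D a)"
    "\<And>a b. D (a * b) = D a * b + a * D b"
  shows "derivation D"
proof -
  have "Vector_Spaces.linear scale scale D"
    unfolding module_hom_iff_linear[symmetric] using vector_space_scale assms
    by (auto intro!: module_hom.intro module_hom_axioms.intro simp: module_def vector_space_def)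
  then show ?thesis using assms(3) unfolding derivation_def by blast
qed

lemma derivation_diff: "derivation (\<lambda>a. D a - E a)" if "derivation D" "derivation E"
  for D :: "('m::monoid_add \<Rightarrow>\<^sub>0 'k::field) \<Rightarrow> ('m \<Rightarrow>\<^sub>0 'k)"
proof -
  have "scale c (a - b) = scale c a - scale c b" for c and a b :: "'m \<Rightarrow>\<^sub>0 'k"
    by (simp add: scale_def algebra_simps)
  then show ?thesis
    by (intro derivationI) (simp_all add: derivationD[OF that(1)] derivationD[OF that(2)] algebra_simps)
qed

lemma derivation_sum:
  assumes "derivation D"
  shows "D (sum f S) = (\<Sum>i\<in>S. D (f i))"
  by (induction S rule: infinite_finite_induct) (simp_all add: derivationD[OF assms])

lemma funpow_derivation:
  assumes D: "derivation D"
  shows "(D ^^ n) 0 = 0" "(D ^^ n) (a + b) = (D ^^ n) a + (D ^^ n) b"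
    "(D ^^ n) (scale c a) = scale c ((D ^^ n) a)" "(D ^^ n) (sum f S) = (\<Sum>i\<in>S. (D ^^ n) (f i))"
proof -
  show *: "(D ^^ n) 0 = 0" "(D ^^ n) (a + b) = (D ^^ n) a + (D ^^ n) b"
    "(D ^^ n) (scale c a) = scale c ((D ^^ n) a)" for a b
    by (induction n) (simp_all add: derivationD[OF D])
  show "(D ^^ n) (sum f S) = (\<Sum>i\<in>S. (D ^^ n) (f i))"
    by (induction S rule: infinite_finite_induct) (simp_all add: *)
qed

lemma funpow_eq_0_mono:
  assumes "derivation D" "(D ^^ m) a = 0" "m \<le> n"
  shows "(D ^^ n) a = 0"
proof -
  have "(D ^^ n) a = (D ^^ (n - m)) ((D ^^ m) a)"
    using assms(3) by (metis comp_apply funpow_add le_add_diff_inverse2)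
  then show ?thesis by (simp add: assms(2) funpow_derivation[OF assms(1)])
qed

lemma single_Nil: "Poly_Mapping.single [] 1 = (1 :: 'k::field free_alg)"
  by (metis single_one zero_list_def)

lemma single_Cons:
  "Poly_Mapping.single (g # w) 1 = free_var g * (Poly_Mapping.single w 1 :: 'k::field free_alg)"
  by (simp add: free_var_def mult_single plus_list_def)

lemma free_alg_expand:
  "a = (\<Sum>w\<in>Poly_Mapping.keys a. scale (Poly_Mapping.lookup a w) (Poly_Mapping.single w 1))"
  for a :: "'k::field free_alg"
  by (rule poly_mapping_eqI)
     (simp add: lookup_sum lookup_single when_def not_in_keys_iff_lookup_eq_zero)

text \<open>Derivations of the free algebra may be prescribed freely on the generators. This is how a
  homogeneous component of a derivation is constructed below: by truncating the images of the
  generators.\<close>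

fun word_derivation :: "(gen \<Rightarrow> 'k::field free_alg) \<Rightarrow> gen list \<Rightarrow> 'k free_alg" where
  "word_derivation h [] = 0"
| "word_derivation h (g # w) = h g * Poly_Mapping.single w 1 + free_var g * word_derivation h w"

lemma word_derivation_append:
  "word_derivation h (u @ v) =
     word_derivation h u * Poly_Mapping.single v 1 + Poly_Mapping.single u 1 * word_derivation h v"
proof (induction u)
  case (Cons g u)
  have "Poly_Mapping.single (u @ v) (1::'a) = Poly_Mapping.single u 1 * Poly_Mapping.single v 1"
    by (simp add: mult_single plus_list_def)
  then show ?case using Cons by (simp add: single_Cons algebra_simps)
qed (simp add: single_Nil)

lemma ex_derivation_extending:
  fixes h :: "gen \<Rightarrow> 'k::field free_alg"
  shows "\<exists>D. derivation D \<and> (\<forall>g. D (free_var g) = h g)"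
proof (intro exI conjI allI)
  let ?D = "lin_ext (word_derivation h)"
  have "?D (a * b) = ?D a * b + a * ?D b" for a b
  proof (induction a rule: pm_induct)
    case (single u c)
    show ?case
    proof (induction b rule: pm_induct)
      case (single v d)
      show ?case
      proof -
        let ?u = "Poly_Mapping.single u (1::'k)" and ?v = "Poly_Mapping.single v (1::'k)"
        have base: "?D (?u * ?v) = ?D ?u * ?v + ?u * ?D ?v"
          by (simp add: mult_single plus_list_def word_derivation_append)
        have "?D (scale c ?u * scale d ?v) = ?D (scale c ?u) * scale d ?v + scale c ?u * ?D (scale d ?v)"
          by (simp only: scale_simps(4,6) mult_scale lin_ext_scale base scale_add(2) mult.commute[of d c])
        then show ?thesis by simp
      qed
    qed (simp_all add: algebra_simps)
  qed (simp_all add: algebra_simps)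
  then show "derivation ?D" by (intro derivationI) simp_all
  show "?D (free_var g) = h g" for g
    by (simp add: free_var_def single_Nil)
qed

lemma keys_times:
  assumes "u \<in> Poly_Mapping.keys (a * b :: 'k::field free_alg)"
  obtains v w where "v \<in> Poly_Mapping.keys a" "w \<in> Poly_Mapping.keys b" "u = v @ w"
  using keys_mult[of a b] assms by (auto simp: plus_list_def)

lemma keys_sum_add:
  assumes "u \<in> Poly_Mapping.keys (a + b)"
  shows "u \<in> Poly_Mapping.keys a \<or> u \<in> Poly_Mapping.keys b"
  using keys_add[of a b] assms by auto

lemma keys_derivation_word:
  fixes D :: "'k::field free_alg \<Rightarrow> 'k free_alg"
  assumes D: "derivation D" and u: "u \<in> Poly_Mapping.keys (D (Poly_Mapping.single w 1))"
  shows "\<exists>p g q v. w = p @ g # q \<and> v \<in> Poly_Mapping.keys (D (free_var g)) \<and> u = p @ v @ q"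
  using u
proof (induction w arbitrary: u)
  case Nil
  then show ?case by (simp add: single_Nil derivationD[OF D])
next
  case (Cons g w)
  then have "u \<in> Poly_Mapping.keys
      (D (free_var g) * Poly_Mapping.single w 1 + free_var g * D (Poly_Mapping.single w 1))"
    by (simp add: single_Cons derivationD[OF D])
  then consider "u \<in> Poly_Mapping.keys (D (free_var g) * Poly_Mapping.single w 1)"
    | "u \<in> Poly_Mapping.keys (free_var g * D (Poly_Mapping.single w 1))"
    using keys_sum_add[of u "D (free_var g) * Poly_Mapping.single w 1"] by blast
  then show ?case
  proof cases
    case 1
    then obtain v where "v \<in> Poly_Mapping.keys (D (free_var g))" "u = v @ w"
      by (auto elim!: keys_times)
    then have "g # w = [] @ g # w \<and> v \<in> Poly_Mapping.keys (D (free_var g)) \<and> u = [] @ v @ w"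
      by simp
    then show ?thesis by blast
  next
    case 2
    then obtain u' where u': "u' \<in> Poly_Mapping.keys (D (Poly_Mapping.single w 1))" "u = g # u'"
      by (auto elim!: keys_times simp: free_var_def)
    obtain p h q v where "w = p @ h # q" "v \<in> Poly_Mapping.keys (D (free_var h))" "u' = p @ v @ q"
      using Cons.IH[OF u'(1)] by blast
    then have "g # w = (g # p) @ h # q \<and> v \<in> Poly_Mapping.keys (D (free_var h)) \<and> u = (g # p) @ v @ q"
      using u'(2) by simp
    then show ?thesis by blast
  qed
qed

text \<open>A derivation acts on words by substituting for one letter at a time. All degree estimates
  below are read off from this.\<close>

lemma keys_derivation:
  fixes D :: "'k::field free_alg \<Rightarrow> 'k free_alg"
  assumes D: "derivation D" and u: "u \<in> Poly_Mapping.keys (D a)"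
  obtains p g q v where "p @ g # q \<in> Poly_Mapping.keys a" "v \<in> Poly_Mapping.keys (D (free_var g))"
    "u = p @ v @ q"
proof -
  have "D a = (\<Sum>w\<in>Poly_Mapping.keys a. scale (Poly_Mapping.lookup a w) (D (Poly_Mapping.single w 1)))"
    by (subst free_alg_expand) (simp only: derivation_sum[OF D] derivationD[OF D])
  then have "u \<in> (\<Union>w\<in>Poly_Mapping.keys a.
      Poly_Mapping.keys (scale (Poly_Mapping.lookup a w) (D (Poly_Mapping.single w 1))))"
    using u keys_sum by fastforce
  then obtain w where w: "w \<in> Poly_Mapping.keys a"
    "u \<in> Poly_Mapping.keys (scale (Poly_Mapping.lookup a w) (D (Poly_Mapping.single w 1)))" by blast
  then have "u \<in> Poly_Mapping.keys (D (Poly_Mapping.single w 1))"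
    unfolding scale_def by (auto elim!: keys_times simp: zero_list_def split: if_splits)
  then show ?thesis using keys_derivation_word[OF D] w(1) that by blast
qed

lemma derivation_eq_0:
  fixes D :: "'k::field free_alg \<Rightarrow> 'k free_alg"
  assumes "derivation D" "\<And>g. D (free_var g) = 0"
  shows "D = (\<lambda>_. 0)"
  by (rule ext) (metis keys_derivation[OF assms(1)] assms(2) keys_zero empty_iff keys_eq_empty ex_in_conv)

text \<open>In the Leibniz expansion of \<open>D ^ (i + j)\<close> applied to a product only one term survives
  when the two factors are killed by \<open>D ^ (i + 1)\<close> and \<open>D ^ (j + 1)\<close>. The induction
  runs on \<open>i + j\<close> through Pascal's rule.\<close>

lemma funpow_derivation_mult_top:
  fixes D :: "('m::monoid_add \<Rightarrow>\<^sub>0 'k::field) \<Rightarrow> ('m \<Rightarrow>\<^sub>0 'k)"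
  assumes D: "derivation D" and "(D ^^ Suc i) a = 0" "(D ^^ Suc j) b = 0"
  shows "(D ^^ (i + j)) (a * b) = scale (of_nat ((i + j) choose i)) ((D ^^ i) a * (D ^^ j) b)"
  using assms(2,3)
proof (induction "i + j" arbitrary: i j a b rule: less_induct)
  case less
  have const_left: "(D ^^ n) (a * b) = a * (D ^^ n) b" if "D a = 0" for n a b
    by (induction n) (simp_all add: derivationD[OF D] that)
  have const_right: "(D ^^ n) (a * b) = (D ^^ n) a * b" if "D b = 0" for n a b
    by (induction n) (simp_all add: derivationD[OF D] that)
  consider "i = 0" | "j = 0" | i' j' where "i = Suc i'" "j = Suc j'"
    by (metis not0_implies_Suc)
  then show ?case
  proof cases
    case 3
    have "(D ^^ Suc i') (D a) = 0" "(D ^^ Suc j') (D b) = 0"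
      using less.prems 3 by (simp_all add: funpow_swap1)
    then have "(D ^^ (i' + j)) (D a * b)
        = scale (of_nat ((i' + j) choose i')) ((D ^^ i') (D a) * (D ^^ j) b)"
      "(D ^^ (i + j')) (a * D b)
        = scale (of_nat ((i + j') choose i)) ((D ^^ i) a * (D ^^ j') (D b))"
      using less.hyps[of i' j] less.hyps[of i j'] less.prems 3 by simp_all
    moreover have "(D ^^ (i + j)) (a * b) = (D ^^ (i' + j)) (D a * b) + (D ^^ (i + j')) (a * D b)"
      using 3 by (simp add: funpow_Suc_right derivationD[OF D] funpow_derivation[OF D] del: funpow.simps)
    ultimately show ?thesis
      using 3 by (simp add: funpow_Suc_right funpow_swap1 flip: scale_add(1))
  qed (use less.prems in \<open>simp_all add: const_left const_right\<close>)
qed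

section \<open>Leading words\<close>

text \<open>Reading a word as a number in bijective base 2 (digits 1 and 2) embeds the words in the
  natural numbers so that the induced order is the shortlex order. Concatenation becomes
  arithmetic, which makes the compatibility of the order with multiplication easy.\<close>

fun word_value :: "gen list \<Rightarrow> nat" where
  "word_value [] = 0"
| "word_value (g # w) = (if g = gen_x then 1 else 2) * 2 ^ length w + word_value w"

lemma word_value_append: "word_value (u @ v) = word_value u * 2 ^ length v + word_value v"
  by (induction u) (simp_all add: algebra_simps power_add)

lemma word_value_bounds: "2 ^ length w \<le> word_value w + 1" "word_value w + 2 \<le> 2 ^ Suc (length w)"
  by (induction w) simp_all

lemma length_le_of_word_value_le:
  assumes "word_value v \<le> word_value w"
  shows "length v \<le> length w"
proof (rule ccontr)
  assume "\<not> length v \<le> length w"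
  then have "2 ^ Suc (length w) \<le> (2::nat) ^ length v" by (intro power_increasing) auto
  then show False using word_value_bounds(1)[of v] word_value_bounds(2)[of w] assms by linarith
qed

lemma word_value_inj: "word_value u = word_value v \<Longrightarrow> u = v"
proof (induction u arbitrary: v)
  case Nil
  then show ?case by (cases v) (auto split: if_splits)
next
  case (Cons g u)
  have len: "length v = Suc (length u)"
    using length_le_of_word_value_le[of v "g # u"] length_le_of_word_value_le[of "g # u" v] Cons.prems by simp
  then obtain h v' where v: "v = h # v'" "length v' = length u" by (cases v) auto
  show ?case
    using Cons.prems Cons.IH[of v'] v word_value_bounds[of u] word_value_bounds[of v']
    by (cases g; cases h) auto
qed

lemma word_value_append_mono:
  assumes "word_value u \<le> word_value u'" "word_value v \<le> word_value v'"
  shows "word_value (u @ v) \<le> word_value (u' @ v')"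
proof -
  have "(2::nat) ^ length v \<le> 2 ^ length v'"
    using length_le_of_word_value_le[OF assms(2)] by (intro power_increasing) auto
  then show ?thesis unfolding word_value_append using assms by (intro add_mono mult_mono) auto
qed

definition leading_word :: "gen list \<Rightarrow> 'k::field free_alg \<Rightarrow> bool" where
  "leading_word u a \<longleftrightarrow> u \<in> Poly_Mapping.keys a \<and> (\<forall>w\<in>Poly_Mapping.keys a. word_value w \<le> word_value u)"

lemma ex_maximizer:
  fixes f :: "'a \<Rightarrow> nat"
  assumes "finite S" "S \<noteq> {}"
  obtains s where "s \<in> S" "\<And>t. t \<in> S \<Longrightarrow> f t \<le> f s"
proof -
  have "Max (f ` S) \<in> f ` S" using assms by simp
  then obtain s where "s \<in> S" "Max (f ` S) = f s" by blast
  moreover have "f t \<le> Max (f ` S)" if "t \<in> S" for t using assms that by simp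
  ultimately show ?thesis using that by simp
qed

lemma ex_leading_word: "\<exists>u. leading_word u a" if "a \<noteq> 0" for a :: "'k::field free_alg"
proof -
  have "finite (Poly_Mapping.keys a)" "Poly_Mapping.keys a \<noteq> {}" using that by simp_all
  then obtain u where "u \<in> Poly_Mapping.keys a" "\<And>w. w \<in> Poly_Mapping.keys a \<Longrightarrow> word_value w \<le> word_value u"
    using ex_maximizer[of "Poly_Mapping.keys a" word_value] by blast
  then show ?thesis unfolding leading_word_def by blast
qed

text \<open>Leading terms cannot cancel in a product: the words of largest value are among the longest
  ones, so if \<open>p @ q = u @ v\<close> with \<open>u\<close>, \<open>v\<close> leading, the lengths of the factors agree and
  \<open>p = u\<close>, \<open>q = v\<close>.\<close>

lemma leading_word_mult:
  fixes a b :: "'k::field free_alg"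
  assumes "leading_word u a" "leading_word v b"
  shows "leading_word (u @ v) (a * b)"
proof -
  define a' where "a' = a - Poly_Mapping.single u (Poly_Mapping.lookup a u)"
  define b' where "b' = b - Poly_Mapping.single v (Poly_Mapping.lookup b v)"
  let ?l = "\<lambda>a u. Poly_Mapping.single u (Poly_Mapping.lookup a u)"
  have split: "a * b = ?l a u * ?l b v + (?l a u * b' + a' * b)"
    by (simp add: a'_def b'_def algebra_simps)
  have "u @ v \<notin> Poly_Mapping.keys (?l a u * b')"
  proof
    assume "u @ v \<in> Poly_Mapping.keys (?l a u * b')"
    then have "v \<in> Poly_Mapping.keys b'" by (auto elim!: keys_times split: if_splits)
    then show False by (simp add: b'_def in_keys_iff lookup_minus)
  qed
  moreover have "u @ v \<notin> Poly_Mapping.keys (a' * b)"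
  proof
    assume "u @ v \<in> Poly_Mapping.keys (a' * b)"
    then obtain p q where pq: "p \<in> Poly_Mapping.keys a'" "q \<in> Poly_Mapping.keys b" "u @ v = p @ q"
      by (auto elim!: keys_times)
    have p: "p \<in> Poly_Mapping.keys a" "p \<noteq> u"
      using pq(1) by (auto simp: a'_def in_keys_iff lookup_minus lookup_single when_def split: if_splits)
    have "length p \<le> length u" "length q \<le> length v"
      using assms p pq by (auto simp: leading_word_def intro: length_le_of_word_value_le)
    then have "p = u" using pq(3)
      by (metis append_eq_append_conv le_antisym length_append nat_add_left_cancel_le add_le_cancel_right)
    then show False using p by simp
  qed
  ultimately have "Poly_Mapping.lookup (a * b) (u @ v) = Poly_Mapping.lookup a u * Poly_Mapping.lookup b v"
    by (simp add: split lookup_add in_keys_iff mult_single plus_list_def)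
  then have "u @ v \<in> Poly_Mapping.keys (a * b)"
    using assms by (simp add: leading_word_def in_keys_iff)
  moreover have "\<forall>w\<in>Poly_Mapping.keys (a * b). word_value w \<le> word_value (u @ v)"
    using assms by (auto elim!: keys_times simp: leading_word_def intro: word_value_append_mono)
  ultimately show ?thesis unfolding leading_word_def by blast
qed

section \<open>Free subalgebras on two generators\<close>

text \<open>Two words that do not commute form a code. If \<open>u\<close> is a prefix of \<open>v\<close>, say
  \<open>v = u v'\<close>, then a relation between \<open>u\<close> and \<open>v\<close> gives a relation between
  the shorter words \<open>u\<close> and \<open>v'\<close>, as in Euclid's algorithm.\<close>

lemma commute_of_relation:
  fixes u v :: "'a list"
  assumes "u @ concat as = v @ concat bs" "set as \<subseteq> {u, v}" "set bs \<subseteq> {u, v}"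
  shows "u @ v = v @ u"
  using assms
proof (induction "length u + length v" arbitrary: u v as bs rule: less_induct)
  case (less u v as bs)
  have step: "p @ q = q @ p"
    if le: "length p \<le> length q" and eq: "p @ concat cs = q @ concat ds"
      and sub: "set cs \<subseteq> {p, q}" "set ds \<subseteq> {p, q}"
      and sz: "length p + length q = length u + length v"
    for p q :: "'a list" and cs ds
  proof (cases "p = []")
    case False
    obtain r where q: "q = p @ r"
      using le eq by (metis append_eq_append_conv_if append_take_drop_id)
    \<comment> \<open>as \<open>q = p @ r\<close>, a nonempty product of \<open>p\<close> and \<open>q\<close> becomes a product of \<open>p\<close> and \<open>r\<close>
      whose first factor is \<open>p\<close>; cancelling \<open>p\<close> in \<open>eq\<close> then yields a relation of the same
      form between \<open>p\<close> and \<open>r\<close>\<close>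
    have expand: "\<exists>es'. concat es = concat es' \<and> set es' \<subseteq> {p, r} \<and> (es' = [] \<or> hd es' = p)"
      if "set es \<subseteq> {p, q}" for es
      using that
    proof (induction es)
      case (Cons e es)
      then obtain es' where "concat es = concat es'" "set es' \<subseteq> {p, r}" by auto
      moreover have "e = p \<or> e = p @ r" using Cons.prems q by auto
      ultimately show ?case
        by (elim disjE) (force intro: exI[of _ "p # es'"], force intro: exI[of _ "p # r # es'"])
    qed (auto intro: exI[of _ "[]"])
    obtain cs' where cs': "concat cs = concat cs'" "set cs' \<subseteq> {p, r}" "cs' = [] \<or> hd cs' = p"
      using expand[OF sub(1)] by blast
    obtain ds' where ds': "concat ds = concat ds'" "set ds' \<subseteq> {p, r}"
      using expand[OF sub(2)] by blast
    have eq': "concat cs' = r @ concat ds'" using eq q cs' ds' by simp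
    show ?thesis
    proof (cases cs')
      case Nil
      then show ?thesis using eq' q by simp
    next
      case (Cons e es)
      then have "p @ concat es = r @ concat ds'" "set es \<subseteq> {p, r}" using eq' cs' by auto
      moreover have "length p + length r < length u + length v"
        using sz q False by (simp flip: length_greater_0_conv)
      ultimately have "p @ r = r @ p" using less.hyps[of p r es ds'] ds'(2) by simp
      then show ?thesis using q by simp
    qed
  qed simp
  show ?case
  proof (cases "length u \<le> length v")
    case True
    show ?thesis using step[OF True less.prems refl] .
  next
    case False
    then have "v @ u = u @ v"
      using step[of v u bs as] less.prems by (simp add: insert_commute)
    then show ?thesis by simp
  qed
qed

lemma substitution_inj:
  fixes U :: "gen \<Rightarrow> 'a list"
  assumes nc: "U gen_x @ U gen_y \<noteq> U gen_y @ U gen_x"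
    and "concat (map U w) = concat (map U w')"
  shows "w = w'"
  using assms(2)
proof (induction w arbitrary: w')
  case Nil
  have "U g \<noteq> []" for g using nc by (cases g) auto
  then show ?case using Nil by (cases w') auto
next
  case (Cons g w)
  have ne: "U g \<noteq> []" for g using nc by (cases g) auto
  then obtain h v where w': "w' = h # v" using Cons.prems by (cases w') auto
  have sub: "set (map U z) \<subseteq> {U gen_x, U gen_y}" for z
  proof -
    have "U g \<in> {U gen_x, U gen_y}" for g by (cases g) auto
    then show ?thesis by auto
  qed
  have "g = h"
  proof (rule ccontr)
    assume "g \<noteq> h"
    then have "U g @ U h = U h @ U g"
      using commute_of_relation[of "U g" "map U w" "U h" "map U v"] Cons.prems w' sub[of w] sub[of v]
      by (cases g; cases h) (auto simp: insert_commute)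
    then show False using nc \<open>g \<noteq> h\<close> by (cases g; cases h) auto
  qed
  then show ?case using Cons w' by auto
qed

lemma leading_word_prod_list:
  assumes "\<And>g. leading_word (U g) (Z g :: 'k::field free_alg)"
  shows "leading_word (concat (map U w)) (prod_list (map Z w))"
  by (induction w) (simp_all add: leading_word_mult assms, simp add: leading_word_def flip: single_Nil)

text \<open>Elements whose leading words do not commute satisfy no polynomial relation: since the
  leading words form a code, distinct monomials in these elements have distinct leading words,
  and the largest of them survives.\<close>

lemma no_relation_of_leading_words:
  fixes Z :: "gen \<Rightarrow> 'k::field free_alg"
  assumes U: "\<And>g. leading_word (U g) (Z g)" and nc: "U gen_x @ U gen_y \<noteq> U gen_y @ U gen_x"
    and S: "finite S" "S \<noteq> {}" and c: "\<And>w. w \<in> S \<Longrightarrow> c w \<noteq> 0"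
  shows "(\<Sum>w\<in>S. scale (c w) (prod_list (map Z w))) \<noteq> 0"
proof -
  let ?V = "\<lambda>w. concat (map U w)" and ?P = "\<lambda>w. prod_list (map Z w)"
  obtain w0 where w0: "w0 \<in> S" "\<And>w. w \<in> S \<Longrightarrow> word_value (?V w) \<le> word_value (?V w0)"
    using ex_maximizer[OF S, of "\<lambda>w. word_value (?V w)"] by blast
  have lead: "leading_word (?V w) (?P w)" for w by (rule leading_word_prod_list[OF U])
  have look: "Poly_Mapping.lookup (scale d a) v = d * Poly_Mapping.lookup a v" for d v and a :: "'k free_alg"
  proof (induction a rule: pm_induct)
    case (add a b)
    then show ?case by (simp add: scale_add lookup_add algebra_simps)
  qed (simp_all add: lookup_single when_def)
  have "Poly_Mapping.lookup (?P w) (?V w0) = 0" if "w \<in> S" "w \<noteq> w0" for w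
  proof (rule ccontr)
    assume "Poly_Mapping.lookup (?P w) (?V w0) \<noteq> 0"
    then have "word_value (?V w0) \<le> word_value (?V w)"
      using lead[of w] by (auto simp: leading_word_def in_keys_iff)
    then have "?V w = ?V w0" using w0(2)[OF that(1)] by (intro word_value_inj) simp
    then show False using substitution_inj[of U, OF nc] that(2) by blast
  qed
  then have "Poly_Mapping.lookup (\<Sum>w\<in>S. scale (c w) (?P w)) (?V w0)
      = (\<Sum>w\<in>S. if w = w0 then c w0 * Poly_Mapping.lookup (?P w0) (?V w0) else 0)"
    unfolding lookup_sum look by (intro sum.cong) auto
  also have "\<dots> = c w0 * Poly_Mapping.lookup (?P w0) (?V w0)" using S w0 by simp
  also have "\<dots> \<noteq> 0" using c[OF w0(1)] lead[of w0] by (simp add: leading_word_def in_keys_iff)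
  finally show ?thesis by auto
qed

section \<open>Top components\<close>

definition homogeneous_in :: "gen \<Rightarrow> nat \<Rightarrow> ('k::field free_alg \<Rightarrow> 'k free_alg) \<Rightarrow> bool" where
  "homogeneous_in c e D \<longleftrightarrow>
     (\<forall>g. \<forall>v\<in>Poly_Mapping.keys (D (free_var g)). count_list v c = count_list [g] c + e)"

lemma count_funpow_homogeneous:
  assumes D: "derivation D" "homogeneous_in c e D"
    and a: "\<And>w. w \<in> Poly_Mapping.keys a \<Longrightarrow> count_list w c = k"
    and "u \<in> Poly_Mapping.keys ((D ^^ n) a)"
  shows "count_list u c = k + n * e"
  using assms(4)
proof (induction n arbitrary: u)
  case (Suc n)
  then have "u \<in> Poly_Mapping.keys (D ((D ^^ n) a))" by simp
  then obtain p g q v where "p @ g # q \<in> Poly_Mapping.keys ((D ^^ n) a)"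
    "v \<in> Poly_Mapping.keys (D (free_var g))" "u = p @ v @ q"
    by (rule keys_derivation[OF D(1)])
  then show ?case using Suc.IH D(2) by (fastforce simp: homogeneous_in_def)
qed (simp add: a)

lemma lookup_restriction:
  "Poly_Mapping.lookup (lin_ext (\<lambda>w. if P w then Poly_Mapping.single w 1 else 0) a) v
     = (if P v then Poly_Mapping.lookup a v else 0)" for a :: "'k::field free_alg"
  by (induction a rule: pm_induct) (auto simp: lookup_add lookup_single when_def)

text \<open>The component of \<open>D\<close> that raises the number of letters \<open>c\<close> by the largest amount
  \<open>e\<close> alone produces the part of \<open>D ^ n\<close> that raises it by \<open>n * e\<close>, so it inherits
  local nilpotency. The hypothesis on \<open>c\<close> makes \<open>e\<close> a natural number: no substitution lowers
  the number of letters \<open>c\<close>. The inclusion of supports lets a second truncation, for the other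
  letter, preserve homogeneity in the first.\<close>

lemma ex_top_component:
  fixes D :: "'k::field free_alg \<Rightarrow> 'k free_alg"
  assumes D: "derivation D" "locally_nilpotent D" "D \<noteq> (\<lambda>_. 0)"
    and full: "\<forall>g. \<forall>v\<in>Poly_Mapping.keys (D (free_var g)). c \<in> set v"
  shows "\<exists>(E :: 'k free_alg \<Rightarrow> 'k free_alg) e. derivation E \<and> locally_nilpotent E \<and> E \<noteq> (\<lambda>_. 0) \<and>
    (\<forall>g. Poly_Mapping.keys (E (free_var g)) \<subseteq> Poly_Mapping.keys (D (free_var g))) \<and>
    homogeneous_in c e E"
proof -
  \<comment> \<open>\<open>e\<close> is the largest increase in the number of letters \<open>c\<close> over all substitutions\<close>
  let ?S = "SIGMA g : {gen_x, gen_y}. Poly_Mapping.keys (D (free_var g))"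
  let ?rise = "\<lambda>(g, v). count_list v c - count_list [g] c"
  have mem: "g \<in> {gen_x, gen_y}" for g by (cases g) auto
  obtain g where "D (free_var g) \<noteq> 0" using derivation_eq_0 D by blast
  then obtain v where "v \<in> Poly_Mapping.keys (D (free_var g))" by (metis keys_eq_empty ex_in_conv)
  then have "(g, v) \<in> ?S" using mem by blast
  then have "?S \<noteq> {}" by blast
  then obtain s where s: "s \<in> ?S" "\<And>t. t \<in> ?S \<Longrightarrow> ?rise t \<le> ?rise s"
    using ex_maximizer[of ?S ?rise] by (metis (no_types, lifting) finite.emptyI finite.insertI finite_SigmaI finite_keys)
  define e where "e = ?rise s"
  obtain g0 v0 where gv: "s = (g0, v0)" by fastforce
  have pos: "count_list [g] c \<le> count_list v c" if "v \<in> Poly_Mapping.keys (D (free_var g))" for g v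
    using full that count_list_0_iff[of v c] by (auto simp: Suc_le_eq)
  have v0: "v0 \<in> Poly_Mapping.keys (D (free_var g0))" "count_list v0 c = count_list [g0] c + e"
    using s(1) pos[of v0 g0] by (auto simp: gv e_def)
  have bound: "count_list v c \<le> count_list [g] c + e" if "v \<in> Poly_Mapping.keys (D (free_var g))" for g v
    using s(2)[of "(g, v)"] that mem[of g] unfolding e_def[symmetric] by (simp split: if_splits)
  define h where "h g = lin_ext (\<lambda>w. if count_list w c = count_list [g] c + e
      then Poly_Mapping.single w 1 else 0) (D (free_var g))" for g
  obtain E where E: "derivation E" "\<And>g. E (free_var g) = h g"
    using ex_derivation_extending by blast
  have E_lookup: "Poly_Mapping.lookup (E (free_var g)) v =
      (if count_list v c = count_list [g] c + e then Poly_Mapping.lookup (D (free_var g)) v else 0)" for g v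
    unfolding E(2) h_def by (rule lookup_restriction)
  have hom: "homogeneous_in c e E"
    unfolding homogeneous_in_def by (auto simp: in_keys_iff E_lookup split: if_splits)
  define R where "R a = D a - E a" for a
  have R: "derivation R" unfolding R_def by (rule derivation_diff[OF D(1) E(1)])
  have R_lt: "count_list v c < count_list [g] c + e" if "v \<in> Poly_Mapping.keys (R (free_var g))" for g v
  proof -
    have "v \<in> Poly_Mapping.keys (D (free_var g))" "count_list v c \<noteq> count_list [g] c + e"
      using that by (auto simp: in_keys_iff R_def lookup_minus E_lookup split: if_splits)
    then show ?thesis using bound[of v g] by simp
  qed
  \<comment> \<open>\<open>E ^ n\<close> gives exactly the top part of \<open>D ^ n\<close>; the difference is of lower degree\<close>
  have word: "count_list u c < count_list w c + n * e"
    if "u \<in> Poly_Mapping.keys ((D ^^ n) (Poly_Mapping.single w 1) - (E ^^ n) (Poly_Mapping.single w 1))"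
    for u w n
    using that
  proof (induction n arbitrary: u)
    case (Suc n)
    let ?w = "Poly_Mapping.single w (1::'k)"
    have "(D ^^ Suc n) ?w = D (((D ^^ n) ?w - (E ^^ n) ?w) + (E ^^ n) ?w)" by simp
    then have "(D ^^ Suc n) ?w - (E ^^ Suc n) ?w = D ((D ^^ n) ?w - (E ^^ n) ?w) + R ((E ^^ n) ?w)"
      unfolding derivationD(1)[OF D(1)] R_def by (simp add: algebra_simps)
    then consider "u \<in> Poly_Mapping.keys (D ((D ^^ n) ?w - (E ^^ n) ?w))"
      | "u \<in> Poly_Mapping.keys (R ((E ^^ n) ?w))"
      using Suc.prems keys_sum_add[of u "D ((D ^^ n) ?w - (E ^^ n) ?w)"] by auto
    then show ?case
    proof cases
      case 1
      then obtain p g q v where u: "p @ g # q \<in> Poly_Mapping.keys ((D ^^ n) ?w - (E ^^ n) ?w)"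
        "v \<in> Poly_Mapping.keys (D (free_var g))" "u = p @ v @ q"
        by (rule keys_derivation[OF D(1)])
      show ?thesis using Suc.IH[OF u(1)] bound[OF u(2)] u(3) by (simp split: if_splits)
    next
      case 2
      then obtain p g q v where u: "p @ g # q \<in> Poly_Mapping.keys ((E ^^ n) ?w)"
        "v \<in> Poly_Mapping.keys (R (free_var g))" "u = p @ v @ q"
        by (rule keys_derivation[OF R])
      have "count_list (p @ g # q) c = count_list w c + n * e"
        using count_funpow_homogeneous[OF E(1) hom _ u(1)] by simp
      then show ?thesis using R_lt[OF u(2)] u(3) by (simp split: if_splits)
    qed
  qed simp
  have "\<exists>n\<ge>1. (E ^^ n) a = 0" for a
  proof (induction a rule: pm_induct)
    case zero
    show ?case by (intro exI[of _ 1]) (simp add: derivationD[OF E(1)])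
  next
    case (single w d)
    let ?w = "Poly_Mapping.single w (1::'k)"
    obtain n where n: "n \<ge> 1" "(D ^^ n) ?w = 0" using D(2) unfolding locally_nilpotent_def by blast
    have "u \<notin> Poly_Mapping.keys ((E ^^ n) ?w)" for u
    proof
      assume u: "u \<in> Poly_Mapping.keys ((E ^^ n) ?w)"
      have "count_list u c = count_list w c + n * e"
        using count_funpow_homogeneous[OF E(1) hom _ u] by simp
      \<comment> \<open>as \<open>D ^ n\<close> kills the word, \<open>u\<close> is also a word of the lower part\<close>
      moreover have "count_list u c < count_list w c + n * e" using word[of u n w] u n(2) by simp
      ultimately show False by simp
    qed
    then have "(E ^^ n) ?w = 0" by (metis keys_eq_empty ex_in_conv)
    then have "(E ^^ n) (Poly_Mapping.single w d) = 0"
      using funpow_derivation(3)[OF E(1), of n d ?w] by simp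
    then show ?case using n by blast
  next
    case (add a b)
    then obtain m n where mn: "m \<ge> 1" "n \<ge> 1" "(E ^^ m) a = 0" "(E ^^ n) b = 0" by blast
    then have "(E ^^ max m n) a = 0" "(E ^^ max m n) b = 0"
      using funpow_eq_0_mono[OF E(1)] by (metis max.cobounded1 max.cobounded2)+
    then have "(E ^^ max m n) (a + b) = 0" by (simp add: funpow_derivation[OF E(1)])
    then show ?case using mn(1) by (intro exI[of _ "max m n"]) simp
  qed
  then have "locally_nilpotent E" unfolding locally_nilpotent_def by blast
  moreover have "E \<noteq> (\<lambda>_. 0)"
  proof
    assume "E = (\<lambda>_. 0)"
    then show False using E_lookup[of g0 v0] v0 by (simp add: in_keys_iff)
  qed
  moreover have "Poly_Mapping.keys (E (free_var g)) \<subseteq> Poly_Mapping.keys (D (free_var g))" for g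
    by (auto simp: in_keys_iff E_lookup split: if_splits)
  ultimately show ?thesis using E(1) hom by blast
qed

section \<open>Bihomogeneous locally nilpotent derivations\<close>

lemma words_not_commuting:
  assumes cnt: "\<And>g c. count_list (U g) c = count_list [g] c + m g * e c"
  shows "U gen_x @ U gen_y \<noteq> U gen_y @ U gen_x"
proof
  assume "U gen_x @ U gen_y = U gen_y @ U gen_x"
  then obtain i j z where z: "concat (replicate i z) = U gen_x" "concat (replicate j z) = U gen_y"
    using comm_append_are_replicate by blast
  have "count_list (concat (replicate k z)) c = k * count_list z c" for k c
    by (induction k) simp_all
  then have xy: "count_list (U gen_x) c = i * count_list z c" "count_list (U gen_y) c = j * count_list z c" for c
    using z by metis+
  \<comment> \<open>powers of one word have proportional letter counts\<close>
  have "count_list (U gen_x) gen_x * count_list (U gen_y) gen_y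
      = count_list (U gen_x) gen_y * count_list (U gen_y) gen_x"
    unfolding xy by simp
  then show False by (simp add: cnt algebra_simps)
qed

text \<open>Let \<open>m g\<close> be the largest exponent with \<open>Z g = D ^ (m g) g \<noteq> 0\<close>, and let \<open>D\<close> shift
  bidegrees by \<open>(a, b)\<close>. The bidegrees \<open>(1 + m x * a, m x * b)\<close> of \<open>Z x\<close> and
  \<open>(m y * a, 1 + m y * b)\<close> of \<open>Z y\<close> have determinant \<open>1 + m x * a + m y * b > 0\<close>. So the
  leading words of \<open>Z x\<close> and \<open>Z y\<close> do not commute, and \<open>Z x\<close>, \<open>Z y\<close> satisfy no relation.

  On the other hand, let \<open>f = D g\<close> be nonzero, and let \<open>d\<close> be the sum of \<open>m\<close> over the letters of
  a word of \<open>f\<close>, which by bihomogeneity is the same for all words of \<open>f\<close>. Then \<open>D ^ d\<close> maps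
  \<open>f\<close> to a combination of its words evaluated at \<open>Z x\<close> and \<open>Z y\<close>, with nonzero coefficients.
  Since \<open>g\<close> occurs in these words, \<open>d \<ge> m g\<close>, so \<open>D ^ d\<close> kills \<open>f = D g\<close>: a relation.\<close>

lemma bihomogeneous_locally_nilpotent_eq_0:
  fixes D :: "'k::field_char_0 free_alg \<Rightarrow> 'k free_alg"
  assumes D: "derivation D" "locally_nilpotent D"
    and full: "\<And>g v c. v \<in> Poly_Mapping.keys (D (free_var g)) \<Longrightarrow> c \<in> set v"
    and hom: "\<And>c. homogeneous_in c (e c) D"
  shows "D = (\<lambda>_. 0)"
proof (rule ccontr)
  assume "D \<noteq> (\<lambda>_. 0)"
  then obtain g0 where g0: "D (free_var g0) \<noteq> 0" using derivation_eq_0[OF D(1)] by blast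
  define m where "m g = (LEAST n. (D ^^ Suc n) (free_var g) = 0)" for g
  define Z where "Z g = (D ^^ m g) (free_var g)" for g
  have m: "(D ^^ Suc (m g)) (free_var g) = 0" for g
  proof -
    obtain n where n: "n \<ge> 1" "(D ^^ n) (free_var g) = 0" using D(2) unfolding locally_nilpotent_def by blast
    then have "(D ^^ Suc (n - 1)) (free_var g) = 0" by simp
    then show ?thesis unfolding m_def by (rule LeastI)
  qed
  have Z_nz: "Z g \<noteq> 0" for g
  proof (cases "m g")
    case 0
    then show ?thesis by (simp add: Z_def free_var_def) (metis lookup_single_eq lookup_zero zero_neq_one)
  next
    case (Suc k)
    then show ?thesis using not_less_Least[of k "\<lambda>n. (D ^^ Suc n) (free_var g) = 0"]
      by (simp add: Z_def m_def)
  qed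
  define U where "U g = (SOME u. leading_word u (Z g))" for g
  have U: "leading_word (U g) (Z g)" for g
    unfolding U_def using ex_leading_word[OF Z_nz] by (rule someI_ex)
  have "count_list (U g) c = count_list [g] c + m g * e c" for g c
  proof (rule count_funpow_homogeneous[OF D(1) hom])
    show "U g \<in> Poly_Mapping.keys ((D ^^ m g) (free_var g))"
      using U[of g] by (simp add: leading_word_def Z_def)
  qed (simp add: free_var_def)
  then have nc: "U gen_x @ U gen_y \<noteq> U gen_y @ U gen_x" by (rule words_not_commuting)

  define deg where "deg w = sum_list (map m w)" for w
  \<comment> \<open>\<open>deg\<close> is additive on words, and the last nonzero iterate of a word is that word evaluated
    at \<open>Z\<close>, up to a product of binomial coefficients; this needs characteristic zero\<close>
  have word: "(D ^^ Suc (deg w)) (Poly_Mapping.single w 1) = 0 \<and>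
      (\<exists>c. c \<noteq> 0 \<and> (D ^^ deg w) (Poly_Mapping.single w 1) = scale c (prod_list (map Z w)))" for w
  proof (induction w)
    case Nil
    have "(D ^^ 0) 1 = scale 1 1" by simp
    then show ?case
      by (auto simp: deg_def single_Nil derivationD[OF D(1)] intro!: exI[of _ 1])
  next
    case (Cons g w)
    then obtain c where c: "c \<noteq> 0" "(D ^^ deg w) (Poly_Mapping.single w 1) = scale c (prod_list (map Z w))"
      by blast
    have eq: "(D ^^ deg (g # w)) (Poly_Mapping.single (g # w) 1)
        = scale (of_nat ((m g + deg w) choose m g)) (Z g * (D ^^ deg w) (Poly_Mapping.single w 1))"
      using funpow_derivation_mult_top[OF D(1) m[of g], of "deg w" "Poly_Mapping.single w 1"] Cons
      by (simp add: single_Cons deg_def Z_def)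
    have "(D ^^ Suc (deg (g # w))) (Poly_Mapping.single (g # w) 1) = 0"
      using m[of g] Cons by (simp add: eq derivationD[OF D(1)] Z_def)
    moreover have "(D ^^ deg (g # w)) (Poly_Mapping.single (g # w) 1)
        = scale (of_nat ((m g + deg w) choose m g) * c) (prod_list (map Z (g # w)))"
      unfolding eq c(2) by (simp add: mult_scale)
    moreover have "of_nat ((m g + deg w) choose m g) * c \<noteq> 0" using c(1) by simp
    ultimately show ?case by blast
  qed
  then obtain C where C: "\<And>w. C w \<noteq> 0"
    "\<And>w. (D ^^ deg w) (Poly_Mapping.single w 1) = scale (C w) (prod_list (map Z w))" by metis

  let ?f = "D (free_var g0)"
  define d where "d = (count_list [g0] gen_x + e gen_x) * m gen_x + (count_list [g0] gen_y + e gen_y) * m gen_y"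
  have "deg w = count_list w gen_x * m gen_x + count_list w gen_y * m gen_y" for w
  proof (induction w)
    case (Cons g w)
    then show ?case by (cases g) (simp_all add: deg_def)
  qed (simp add: deg_def)
  then have deg: "deg w = d" if "w \<in> Poly_Mapping.keys ?f" for w
    using hom that unfolding homogeneous_in_def d_def by metis
  have "(D ^^ d) ?f = (\<Sum>w\<in>Poly_Mapping.keys ?f. scale (Poly_Mapping.lookup ?f w) ((D ^^ d) (Poly_Mapping.single w 1)))"
    by (subst free_alg_expand) (simp only: funpow_derivation[OF D(1)])
  also have "\<dots> = (\<Sum>w\<in>Poly_Mapping.keys ?f. scale (Poly_Mapping.lookup ?f w * C w) (prod_list (map Z w)))"
  proof (rule sum.cong)
    fix w assume "w \<in> Poly_Mapping.keys ?f"
    then have "(D ^^ d) (Poly_Mapping.single w 1) = scale (C w) (prod_list (map Z w))" using C(2)[of w] deg by simp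
    then show "scale (Poly_Mapping.lookup ?f w) ((D ^^ d) (Poly_Mapping.single w 1))
        = scale (Poly_Mapping.lookup ?f w * C w) (prod_list (map Z w))" by simp
  qed simp
  also have "\<dots> \<noteq> 0"
    using g0 C(1) by (intro no_relation_of_leading_words[OF U nc]) (auto simp: in_keys_iff)
  finally have "(D ^^ Suc d) (free_var g0) \<noteq> 0" by (simp add: funpow_swap1)
  moreover have "(D ^^ Suc d) (free_var g0) = 0"
  proof (rule funpow_eq_0_mono[OF D(1) m])
    obtain w where w: "w \<in> Poly_Mapping.keys ?f" using g0 by (metis keys_eq_empty ex_in_conv)
    then have "m g0 \<le> deg w" unfolding deg_def using full[OF w, of g0] by (intro member_le_sum_list) auto
    then show "Suc (m g0) \<le> Suc d" using deg[OF w] by simp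
  qed
  ultimately show False by blast
qed

section \<open>Derivations vanishing on the abelianization\<close>

lemma lookup_word_content: "Poly_Mapping.lookup (word_content w) c = count_list w c"
  by (induction w) (auto simp: lookup_add lookup_single when_def)

text \<open>A power of a single generator is the only word with its commutative image, so its
  coefficient can be read off from the abelianization.\<close>

lemma keys_of_abelianize_eq_0:
  fixes a :: "'k::field free_alg"
  assumes "abelianize a = 0" and w: "w \<in> Poly_Mapping.keys a"
  shows "c \<in> set w"
proof (rule ccontr)
  assume c: "c \<notin> set w"
  have uniq: "v = w" if "word_content v = word_content w" for v
  proof -
    have cnt: "count_list v g = count_list w g" for g
      using that by (metis lookup_word_content)
    then have "c \<notin> set v" using c by (metis count_list_0_iff)
    moreover obtain g where g: "\<And>h. h \<noteq> c \<Longrightarrow> h = g" by (metis gen.exhaust)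
    ultimately have "set v \<subseteq> {g}" "set w \<subseteq> {g}" using c by (metis singletonI subsetI)+
    then have "v = replicate (length v) g" "w = replicate (length w) g"
      by (auto intro!: replicate_eqI)
    moreover have "length u = count_list u g" if "set u \<subseteq> {g}" for u
      using that by (induction u) auto
    ultimately show ?thesis using cnt \<open>set v \<subseteq> {g}\<close> \<open>set w \<subseteq> {g}\<close> by metis
  qed
  have "Poly_Mapping.lookup (abelianize a) (word_content w) = Poly_Mapping.lookup a w" for a :: "'k free_alg"
  proof (induction a rule: pm_induct)
    case (single v d)
    have "(word_content v = word_content w) = (v = w)" using uniq by auto
    then show ?case by (simp add: prod_list_poly_var lookup_single when_def)
  qed (simp_all add: lookup_add)
  then show False using assms by (metis in_keys_iff lookup_zero)
qed

theorem corollary28: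
  shows "(\<forall>D :: 'k::{alg_closed_field, field_char_0} free_alg \<Rightarrow> 'k free_alg.
            derivation D \<longrightarrow> locally_nilpotent D \<longrightarrow> pi_star D = (\<lambda>_. 0) \<longrightarrow> D = (\<lambda>_. 0))
       \<and> {D \<in> Der. pi_star D = (\<lambda>_. 0)} \<inter> LND = {(\<lambda>_. 0) :: 'k free_alg \<Rightarrow> 'k free_alg}"
proof -
  have main: "D = (\<lambda>_. 0)"
    if D: "derivation D" "locally_nilpotent D" and ab: "pi_star D = (\<lambda>_. 0)"
    for D :: "'k free_alg \<Rightarrow> 'k free_alg"
  proof (rule ccontr)
    assume nz: "D \<noteq> (\<lambda>_. 0)"
    have full: "c \<in> set v" if "v \<in> Poly_Mapping.keys (D (free_var g))" for v g c
      using keys_of_abelianize_eq_0[OF _ that] pi_star_props(2)[OF D(1)] ab by metis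
    obtain E :: "'k free_alg \<Rightarrow> 'k free_alg" and a where E: "derivation E" "locally_nilpotent E" "E \<noteq> (\<lambda>_. 0)"
      "\<And>g. Poly_Mapping.keys (E (free_var g)) \<subseteq> Poly_Mapping.keys (D (free_var g))"
      "homogeneous_in gen_x a E"
      using ex_top_component[OF D nz, of gen_x] full by blast
    have fullE: "c \<in> set v" if "v \<in> Poly_Mapping.keys (E (free_var g))" for v g c
      using full that E(4) by blast
    obtain B :: "'k free_alg \<Rightarrow> 'k free_alg" and b where B: "derivation B" "locally_nilpotent B" "B \<noteq> (\<lambda>_. 0)"
      "\<And>g. Poly_Mapping.keys (B (free_var g)) \<subseteq> Poly_Mapping.keys (E (free_var g))"
      "homogeneous_in gen_y b B"
      using ex_top_component[OF E(1-3), of gen_y] fullE by blast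
    have "homogeneous_in gen_x a B"
      using E(5) B(4) unfolding homogeneous_in_def by blast
    then have "homogeneous_in c (case c of gen_x \<Rightarrow> a | gen_y \<Rightarrow> b) B" for c
      using B(5) by (cases c) simp_all
    then have "B = (\<lambda>_. 0)"
      using fullE B(4) by (intro bihomogeneous_locally_nilpotent_eq_0[OF B(1,2)]) blast+
    then show False using B(3) by contradiction
  qed
  moreover have "(\<lambda>_. 0) \<in> {D \<in> Der. pi_star D = (\<lambda>_. 0)} \<inter> (LND :: ('k free_alg \<Rightarrow> 'k free_alg) set)"
  proof -
    have zero: "derivation (\<lambda>_. 0 :: 'k free_alg)" by (intro derivationI) simp_all
    have "pi_star (\<lambda>_. 0 :: 'k free_alg) p = 0" for p
      using pi_star_props(2)[OF zero] surj_abelianize by (metis abelianize_zero surjD)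
    moreover have "locally_nilpotent (\<lambda>_. 0 :: 'k free_alg)"
      unfolding locally_nilpotent_def by (auto intro: exI[of _ 1])
    ultimately show ?thesis using zero by (auto simp: Der_def LND_def)
  qed
  ultimately show ?thesis unfolding Der_def LND_def by blast
qed

end
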